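(* Let $\mathbf{X}$ be a random variable with values in $\mathbb{Z}$ whose characteristic function $\Phi_{\mathbf{X}}$ has no zeros on the unit circle, i.e., $\Phi_{\mathbf{X}}(\mu)\neq 0$ for all $\mu\in[-\pi,\pi]$. Then the integral $$\hat{c}_{\mathbf{X}}[n]=\frac{1}{2\pi}\int_{-\pi}^{\pi}\log\Phi_{\mathbf{X}}(\mu)\,e^{-\jmath\mu n}\,\mathrm{d}\mu$$ giving the complex muculants $\hat{c}_{\mathbf{X}}[n]$, $n\in\mathbb{Z}$, is well-defined if and only if $$\frac{1}{2\pi}\int_{-\pi}^{\pi}\ln|\Phi_{\mathbf{X}}(\mu)|\,\mathrm{d}\mu>-\infty .$$
   Context: $\jmath$ denotes the imaginary unit. For a random variable $\mathbf{X}$ with values in $\mathbb{Z}$, the characteristic function is $\Phi_{\mathbf{X}}(\mu)=\mathbb{E}(e^{\jmath\mu\mathbf{X}})$, $\mu\in\mathbb{R}$; it is $2\pi$-periodic, and is thus regarded as a function of the point $e^{\jmath\mu}$ on the unit circle. The complex logarithm is $\log\Phi_{\mathbf{X}}(\mu)=\ln|\Phi_{\mathbf{X}}(\mu)|+\jmath\,\arg^*(\Phi_{\mathbf{X}}(\mu))$, where $\ln$ is the natural logarithm and $\arg^*(\Phi_{\mathbf{X}}(\mu))=\mathrm{Arg}(\Phi_{\mathbf{X}}(\mu))+2k\pi$, with $\mathrm{Arg}$ the principal argument and the integers $k\in\mathbb{Z}$ (depending on $\mu$) such that $\arg^*(\Phi_{\mathbf{X}}(\mu))$ is continuous in $\mu$.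 The complex muculants $\{\hat{c}_{\mathbf{X}}[n]\}_{n\in\mathbb{Z}}$ are the coefficients of the Fourier series expansion (if it exists) $\log\Phi_{\mathbf{X}}(\mu)=\sum_{n=-\infty}^{\infty}\hat{c}_{\mathbf{X}}[n]e^{\jmath\mu n}$. The integral giving $\hat{c}_{\mathbf{X}}[n]$ is well-defined iff its integrand is absolutely integrable, i.e., iff $\int_{-\pi}^{\pi}|\log\Phi_{\mathbf{X}}(\mu)|\,\mathrm{d}\mu<\infty$. *)

theory Defs
  imports "HOL-Probability.Probability"
begin

definition char_rv :: "'a measure \<Rightarrow> ('a \<Rightarrow> int) \<Rightarrow> real \<Rightarrow> complex" where
  "char_rv M X = char (distr M borel (\<lambda>\<omega>. real_of_int (X \<omega>)))"

lemma char_rv_eq_expectation: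
  assumes "X \<in> measurable M (count_space UNIV)"
  shows "char_rv M X \<mu> = (CLINT \<omega>|M. exp (\<i> * complex_of_real \<mu> * of_int (X \<omega>)))"
proof -
  have "(\<lambda>\<omega>. real_of_int (X \<omega>)) \<in> borel_measurable M"
    using assms by measurable
  then show ?thesis
    by (simp add: char_rv_def char_def integral_distr mult.assoc)
qed

definition arg_star :: "'a measure \<Rightarrow> ('a \<Rightarrow> int) \<Rightarrow> (real \<Rightarrow> int) \<Rightarrow> real \<Rightarrow> real" where
  "arg_star M X k \<mu> = Arg (char_rv M X \<mu>) + 2 * of_int (k \<mu>) * pi"

text \<open>
  The integers \<open>k \<mu>\<close> are admissible if they make \<open>arg_star\<close> continuous on one period. This fixes
  \<open>k\<close> only up to an additive integer constant. Periodicity of \<open>arg_star\<close> is not required: for a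
  constant \<open>X = m\<close> the continuous argument is \<open>m * \<mu>\<close>.
\<close>

definition admissible_branch :: "'a measure \<Rightarrow> ('a \<Rightarrow> int) \<Rightarrow> (real \<Rightarrow> int) \<Rightarrow> bool" where
  "admissible_branch M X k \<longleftrightarrow> continuous_on {-pi..pi} (arg_star M X k)"

text \<open>Meaningful only where \<open>char_rv M X \<mu> \<noteq> 0\<close>, since \<open>ln 0 = 0\<close> and \<open>Arg 0 = 0\<close> in HOL.\<close>

definition log_char :: "'a measure \<Rightarrow> ('a \<Rightarrow> int) \<Rightarrow> (real \<Rightarrow> int) \<Rightarrow> real \<Rightarrow> complex" where
  "log_char M X k \<mu> =
     complex_of_real (ln (cmod (char_rv M X \<mu>))) + \<i> * complex_of_real (arg_star M X k \<mu>)"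

definition muculant_integrand ::
    "'a measure \<Rightarrow> ('a \<Rightarrow> int) \<Rightarrow> (real \<Rightarrow> int) \<Rightarrow> int \<Rightarrow> real \<Rightarrow> complex" where
  "muculant_integrand M X k n \<mu> = log_char M X k \<mu> * exp (- \<i> * complex_of_real \<mu> * of_int n)"

definition complex_muculant ::
    "'a measure \<Rightarrow> ('a \<Rightarrow> int) \<Rightarrow> (real \<Rightarrow> int) \<Rightarrow> int \<Rightarrow> complex" where
  "complex_muculant M X k n =
     1 / (2 * complex_of_real pi) * (\<integral>\<mu>\<in>{-pi..pi}. muculant_integrand M X k n \<mu> \<partial>lebesgue)"

text \<open>
  The Bochner integral in \<open>complex_muculant\<close> is \<open>0\<close> by convention for a non-integrable integrand,
  so that the integral is well-defined has to be stated separately.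
\<close>

definition muculant_well_defined ::
    "'a measure \<Rightarrow> ('a \<Rightarrow> int) \<Rightarrow> (real \<Rightarrow> int) \<Rightarrow> int \<Rightarrow> bool" where
  "muculant_well_defined M X k n \<longleftrightarrow>
     muculant_integrand M X k n absolutely_integrable_on {-pi..pi}"

text \<open>
  The Lebesgue integral with values in \<open>[-\<infinity>, \<infinity>]\<close>, as integral of the positive part minus integral
  of the negative part (\<open>ennreal\<close> truncates negative reals to \<open>0\<close>). It is meaningful unless both
  parts are infinite; for \<open>ln \<bar>\<Phi>\<bar> \<le> 0\<close> the positive part is \<open>0\<close>.
\<close>

definition extended_integral :: "real set \<Rightarrow> (real \<Rightarrow> real) \<Rightarrow> ereal" where
  "extended_integral A f =
     enn2ereal (\<integral>\<^sup>+x\<in>A. ennreal (f x) \<partial>lebesgue) - enn2ereal (\<integral>\<^sup>+x\<in>A. ennreal (- f x) \<partial>lebesgue)"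

lemma continuous_on_char_rv:
  assumes "prob_space M" "X \<in> measurable M (count_space UNIV)"
  shows "continuous_on A (char_rv M X)"
proof -
  have "(\<lambda>\<omega>. real_of_int (X \<omega>)) \<in> borel_measurable M"
    using assms(2) by measurable
  then interpret real_distribution "distr M borel (\<lambda>\<omega>. real_of_int (X \<omega>))"
    using prob_space.real_distribution_distr[OF assms(1)] by blast
  show ?thesis
    unfolding char_rv_def by (simp add: continuous_at_imp_continuous_on isCont_char)
qed

lemma admissible_branch_exists:
  assumes "prob_space M" "X \<in> measurable M (count_space UNIV)"
    and nz: "\<forall>\<mu>\<in>{-pi..pi}. char_rv M X \<mu> \<noteq> 0"
  shows "\<exists>k. admissible_branch M X k"
proof -
  have "contractible {-pi..pi}"
    by (intro convex_imp_contractible convex_real_interval)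
  from continuous_logarithm_on_contractible[OF continuous_on_char_rv[OF assms(1,2)] this bspec[OF nz]]
  obtain g where g: "continuous_on {-pi..pi} g"
      "\<And>\<mu>. \<mu> \<in> {-pi..pi} \<Longrightarrow> char_rv M X \<mu> = exp (g \<mu>)"
    by blast
  have "\<exists>m::int. Im (g \<mu>) = Arg (char_rv M X \<mu>) + 2 * of_int m * pi"
    if "\<mu> \<in> {-pi..pi}" for \<mu>
  proof -
    have "exp (g \<mu>) = exp (Ln (char_rv M X \<mu>))"
      using that g(2) nz by simp
    then obtain m :: int where "g \<mu> = Ln (char_rv M X \<mu>) + (of_int (2 * m) * pi) * \<i>"
      unfolding exp_eq by blast
    then have "Im (g \<mu>) = Im (Ln (char_rv M X \<mu>)) + 2 * of_int m * pi"
      by simp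
    then show ?thesis
      using that nz by (auto simp: Arg_eq_Im_Ln)
  qed
  then obtain k :: "real \<Rightarrow> int" where
    k: "\<And>\<mu>. \<mu> \<in> {-pi..pi} \<Longrightarrow> Im (g \<mu>) = arg_star M X k \<mu>"
    unfolding arg_star_def by metis
  have "continuous_on {-pi..pi} (\<lambda>\<mu>. Im (g \<mu>))"
    by (rule continuous_on_Im[OF g(1)])
  moreover have "continuous_on {-pi..pi} (\<lambda>\<mu>. Im (g \<mu>)) \<longleftrightarrow> continuous_on {-pi..pi} (arg_star M X k)"
    by (rule continuous_on_cong[OF refl k])
  ultimately show ?thesis
    unfolding admissible_branch_def by blast
qed

end

theory Submission
  imports Defs
begin

text \<open>
  The characteristic function is continuous, and without zeros on the compact interval
  \<open>[-\<pi>, \<pi>]\<close> its modulus stays away from \<open>0\<close> there. Hence \<open>ln \<bar>\<Phi>\<bar>\<close> is continuous and its integral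
  is finite; together with the continuous branch of the argument, the complex logarithm is
  continuous too, so every muculant integrand is absolutely integrable. The equivalence therefore
  holds because its two sides are both true, as \<open>muculant_well_defined\<close> and
  \<open>extended_integral_gt_minus_infinity\<close> show.
\<close>

text \<open>
  Integrability makes the integral of the negative part finite, and subtracting a finite number
  from an element of \<open>[0, \<infinity>]\<close> cannot give \<open>-\<infinity>\<close>.
\<close>

lemma extended_integral_gt_minus_infinity:
  assumes "f absolutely_integrable_on A"
  shows "-\<infinity> < extended_integral A f"
proof -
  have eq: "ennreal (- f x) * indicator A x = ennreal (- (indicator A x *\<^sub>R f x))" for x
    by (simp add: indicator_def)
  have "(\<integral>\<^sup>+x. ennreal (- (indicator A x *\<^sub>R f x)) \<partial>lebesgue) \<noteq> \<infinity>"
    using assms unfolding set_integrable_def real_integrable_def by blast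
  then have "enn2ereal (\<integral>\<^sup>+x\<in>A. ennreal (- f x) \<partial>lebesgue) \<noteq> \<infinity>"
    unfolding eq by (metis e2ennreal_enn2ereal e2ennreal_infty infinity_ennreal_def)
  moreover have "enn2ereal (\<integral>\<^sup>+x\<in>A. ennreal (f x) \<partial>lebesgue) \<noteq> -\<infinity>"
    using enn2ereal_nonneg[of "\<integral>\<^sup>+x\<in>A. ennreal (f x) \<partial>lebesgue"] by auto
  ultimately show ?thesis
    unfolding extended_integral_def by (cases rule: ereal2_cases[of "enn2ereal (\<integral>\<^sup>+x\<in>A. ennreal (f x) \<partial>lebesgue)"
          "enn2ereal (\<integral>\<^sup>+x\<in>A. ennreal (- f x) \<partial>lebesgue)"]) simp_all
qed

lemma continuous_on_ln_cmod_char_rv: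
  assumes "prob_space M" "X \<in> measurable M (count_space UNIV)"
    and "\<forall>\<mu>\<in>A. char_rv M X \<mu> \<noteq> 0"
  shows "continuous_on A (\<lambda>\<mu>. ln (cmod (char_rv M X \<mu>)))"
  using assms(3) by (intro continuous_intros continuous_on_char_rv[OF assms(1,2)]) auto

lemma muculant_well_defined:
  assumes "prob_space M" "X \<in> measurable M (count_space UNIV)"
    and "\<forall>\<mu>\<in>{-pi..pi}. char_rv M X \<mu> \<noteq> 0"
    and "admissible_branch M X k"
  shows "muculant_well_defined M X k n"
proof -
  have "continuous_on {-pi..pi} (muculant_integrand M X k n)"
    unfolding muculant_integrand_def log_char_def
    by (intro continuous_intros continuous_on_ln_cmod_char_rv assms(1-3)
        assms(4)[unfolded admissible_branch_def])
  then show ?thesis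
    unfolding muculant_well_defined_def by (rule absolutely_integrable_continuous_real)
qed

theorem mainTheorem4:
  fixes M :: "'a measure" and X :: "'a \<Rightarrow> int" and k :: "real \<Rightarrow> int" and n :: int
  assumes "prob_space M"
    and "X \<in> measurable M (count_space UNIV)"
    and "\<forall>\<mu>\<in>{-pi..pi}. char_rv M X \<mu> \<noteq> 0"
    and "admissible_branch M X k"
  shows "muculant_well_defined M X k n \<longleftrightarrow>
    ereal (1 / (2 * pi)) * extended_integral {-pi..pi} (\<lambda>\<mu>. ln (cmod (char_rv M X \<mu>))) > -\<infinity>"
proof -
  let ?I = "extended_integral {-pi..pi} (\<lambda>\<mu>. ln (cmod (char_rv M X \<mu>)))"
  have "-\<infinity> < ?I"
    by (intro extended_integral_gt_minus_infinity absolutely_integrable_continuous_real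
        continuous_on_ln_cmod_char_rv assms(1-3))
  then have "-\<infinity> < ereal (1 / (2 * pi)) * ?I"
    by (cases ?I) auto
  then show ?thesis
    using muculant_well_defined[OF assms] by blast
qed

end
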